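(* Let $R$ be a ring, let $B$ be a left $R$-module and let $A$ be a submodule of $B$. If $A$ and $B/A$ are Rad-supplementing, then so is $B$.
   Context: Rings are associative with identity and modules are unitary left modules. For a module $M$, $\operatorname{Rad} M$ denotes the radical of $M$ (the intersection of all maximal submodules of $M$, equal to $M$ if there are none). For submodules $U,V$ of a module $N$, $V$ is a Rad-supplement of $U$ in $N$ if $U+V=N$ and $U\cap V\subseteq \operatorname{Rad} V$. A module $M$ is Rad-supplementing if $M$ has a Rad-supplement in every module $N$ that contains $M$ as a submodule. *)

theory Defs
  imports "HOL-Algebra.Module" "HOL-Algebra.AbelCoset"
begin

text \<open>
  HOL-Algebra's \<^locale>\<open>module\<close> requires a commutative ring of scalars; the following is the
  same axiom system over an arbitrary unital ring. The predicate \<^const>\<open>submodule\<close> of the library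
  does not depend on commutativity and is used as is.
\<close>

locale left_module = R?: ring R + M?: abelian_group M
  for R :: "('r, 'k) ring_scheme" (structure) and M :: "('r, 'm, 'c) module_scheme" (structure) +
  assumes smult_closed [simp, intro]:
      "\<lbrakk>a \<in> carrier R; x \<in> carrier M\<rbrakk> \<Longrightarrow> a \<odot>\<^bsub>M\<^esub> x \<in> carrier M"
    and smult_l_distr:
      "\<lbrakk>a \<in> carrier R; b \<in> carrier R; x \<in> carrier M\<rbrakk> \<Longrightarrow>
        (a \<oplus> b) \<odot>\<^bsub>M\<^esub> x = a \<odot>\<^bsub>M\<^esub> x \<oplus>\<^bsub>M\<^esub> b \<odot>\<^bsub>M\<^esub> x"
    and smult_r_distr:
      "\<lbrakk>a \<in> carrier R; x \<in> carrier M; y \<in> carrier M\<rbrakk> \<Longrightarrow>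
        a \<odot>\<^bsub>M\<^esub> (x \<oplus>\<^bsub>M\<^esub> y) = a \<odot>\<^bsub>M\<^esub> x \<oplus>\<^bsub>M\<^esub> a \<odot>\<^bsub>M\<^esub> y"
    and smult_assoc1:
      "\<lbrakk>a \<in> carrier R; b \<in> carrier R; x \<in> carrier M\<rbrakk> \<Longrightarrow>
        (a \<otimes> b) \<odot>\<^bsub>M\<^esub> x = a \<odot>\<^bsub>M\<^esub> (b \<odot>\<^bsub>M\<^esub> x)"
    and smult_one [simp]:
      "x \<in> carrier M \<Longrightarrow> \<one> \<odot>\<^bsub>M\<^esub> x = x"

text \<open>
  The fields \<^const>\<open>mult\<close> and \<^const>\<open>one\<close> of a module record carry no meaning for modules.
  In the scalar action all cosets in the union coincide, so \<open>r\<close> acts on \<open>C\<close> by sending it to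
  the coset of \<open>r \<odot> x\<close> for any representative \<open>x\<close>.
\<close>

definition quotient_module ::
    "('r, 'm, 'c) module_scheme \<Rightarrow> 'm set \<Rightarrow> ('r, 'm set) module"
  where "quotient_module M A =
    \<lparr>carrier = a_rcosets\<^bsub>M\<^esub> A, mult = undefined, one = undefined, zero = A, add = set_add M,
     smult = (\<lambda>r C. \<Union>x\<in>C. A +>\<^bsub>M\<^esub> (r \<odot>\<^bsub>M\<^esub> x))\<rparr>"

definition maximal_submodule ::
    "'m set \<Rightarrow> ('r, 'k) ring_scheme \<Rightarrow> ('r, 'm, 'c) module_scheme \<Rightarrow> bool"
  where "maximal_submodule K R M \<longleftrightarrow>
    submodule K R M \<and> K \<noteq> carrier M \<and>
    (\<forall>L. submodule L R M \<and> K \<subseteq> L \<longrightarrow> L = K \<or> L = carrier M)"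

text \<open>Intersecting with the carrier makes the radical the whole module if there is no maximal
  submodule.\<close>

definition Rad :: "('r, 'k) ring_scheme \<Rightarrow> ('r, 'm, 'c) module_scheme \<Rightarrow> 'm set"
  where "Rad R M = carrier M \<inter> \<Inter>{K. maximal_submodule K R M}"

definition rad_supplement ::
    "('r, 'k) ring_scheme \<Rightarrow> ('r, 'm, 'c) module_scheme \<Rightarrow> 'm set \<Rightarrow> 'm set \<Rightarrow> bool"
  where "rad_supplement R N U V \<longleftrightarrow>
    submodule U R N \<and> submodule V R N \<and>
    U <+>\<^bsub>N\<^esub> V = carrier N \<and> U \<inter> V \<subseteq> Rad R (N\<lparr>carrier := V\<rparr>)"

definition module_embedding ::
    "('r, 'k) ring_scheme \<Rightarrow> ('r, 'm, 'c) module_scheme \<Rightarrow> ('r, 'n, 'd) module_scheme \<Rightarrow>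
      ('m \<Rightarrow> 'n) \<Rightarrow> bool"
  where "module_embedding R M N f \<longleftrightarrow>
    f \<in> hom (add_monoid M) (add_monoid N) \<and>
    (\<forall>r\<in>carrier R. \<forall>x\<in>carrier M. f (r \<odot>\<^bsub>M\<^esub> x) = r \<odot>\<^bsub>N\<^esub> f x) \<and>
    inj_on f (carrier M)"

text \<open>
  A module containing \<open>M\<close> is a module \<open>N\<close> together with an embedding of \<open>M\<close> into \<open>N\<close>; literal
  inclusion would force \<open>N\<close> to live on the type underlying \<open>M\<close>, which may leave no room for
  proper extensions. A formula of HOL cannot quantify over types, so the type \<open>'n\<close> underlying
  the modules \<open>N\<close> is a parameter: it plays the role of the universe of modules under
  consideration. The unrestricted notion is
  \<open>rad_supplementing TYPE('n) R M\<close> for every type \<open>'n\<close>.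
\<close>

definition rad_supplementing ::
    "'n itself \<Rightarrow> ('r, 'k) ring_scheme \<Rightarrow> ('r, 'm, 'c) module_scheme \<Rightarrow> bool"
  where "rad_supplementing (_ :: 'n itself) R M \<longleftrightarrow>
    (\<forall>(N :: ('r, 'n) module) f. left_module R N \<and> module_embedding R M N f \<longrightarrow>
      (\<exists>V. rad_supplement R N (f ` carrier M) V))"

end

theory Submission
  imports Defs
begin

text \<open>
  Let \<open>B \<subseteq> N\<close>. Lift a Rad-supplement of \<open>B/A\<close> in \<open>N/A\<close> to a submodule \<open>V \<supseteq> A\<close> of \<open>N\<close> and
  take a Rad-supplement \<open>W\<close> of \<open>A\<close> in \<open>V\<close>. Then \<open>B + W = B + A + W = B + V = N\<close>. The projection
  maps \<open>W\<close> onto \<open>V/A\<close> with kernel \<open>A \<inter> W \<subseteq> Rad W\<close>, so every maximal submodule of \<open>W\<close> contains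
  the kernel and has a maximal image. Hence \<open>B \<inter> W\<close>, whose image lies in \<open>Rad (V/A)\<close>, lies in
  \<open>Rad W\<close>. To stay in the universe \<open>'n\<close>, the quotient \<open>N/A\<close> is realised on coset
  representatives in \<open>N\<close>.
\<close>

section \<open>Submodules and homomorphisms\<close>

context left_module
begin

section \<open>Scaling by minus one, and the submodule criterion\<close>

lemma smult_l_zero: "x \<in> carrier M \<Longrightarrow> \<zero> \<odot>\<^bsub>M\<^esub> x = \<zero>\<^bsub>M\<^esub>"
  using smult_l_distr[of \<zero> \<zero> x] by simp

lemma smult_minus_one:
  assumes "x \<in> carrier M"
  shows "(\<ominus> \<one>) \<odot>\<^bsub>M\<^esub> x = \<ominus>\<^bsub>M\<^esub> x"
proof -
  have "(\<ominus> \<one>) \<odot>\<^bsub>M\<^esub> x \<oplus>\<^bsub>M\<^esub> x = \<zero>\<^bsub>M\<^esub>"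
    using smult_l_distr[of "\<ominus> \<one>" \<one> x] assms by (simp add: smult_l_zero R.l_neg)
  then show ?thesis
    using assms by (simp add: M.minus_equality[symmetric])
qed

text \<open>Negatives come from the scalar action, as -x = (-1)x; this supplies the inverse clause
  of the subgroup inside \<open>submodule\<close>.\<close>

lemma submodule_iff:
  "submodule H R M \<longleftrightarrow>
    H \<subseteq> carrier M \<and> \<zero>\<^bsub>M\<^esub> \<in> H \<and> (\<forall>x\<in>H. \<forall>y\<in>H. x \<oplus>\<^bsub>M\<^esub> y \<in> H) \<and>
    (\<forall>a\<in>carrier R. \<forall>x\<in>H. a \<odot>\<^bsub>M\<^esub> x \<in> H)" (is "_ \<longleftrightarrow> ?rhs")
proof
  assume "submodule H R M"
  then show ?rhs
    by (auto simp: submodule_def submodule_axioms_def subgroup_def)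
next
  assume rhs: ?rhs
  then have "\<ominus>\<^bsub>M\<^esub> x \<in> H" if "x \<in> H" for x
    using that smult_minus_one[of x] R.a_inv_closed[OF R.one_closed] by (metis subsetD)
  with rhs show "submodule H R M"
    by (auto simp: submodule_def submodule_axioms_def subgroup_def a_inv_def)
qed

lemma submodule_a_inv_closed: "submodule H R M \<Longrightarrow> x \<in> H \<Longrightarrow> \<ominus>\<^bsub>M\<^esub> x \<in> H"
  using smult_minus_one[of x] R.a_inv_closed[OF R.one_closed] by (metis submodule_iff subsetD)

lemma submodule_abelian_subgroup: "submodule H R M \<Longrightarrow> abelian_subgroup H M"
  by (intro abelian_subgroupI3 additive_subgroupI M.abelian_group_axioms)
    (simp add: submodule_def)

lemma left_module_submodule:
  assumes "submodule H R M"
  shows "left_module R (M\<lparr>carrier := H\<rparr>)"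
proof -
  have H: "H \<subseteq> carrier M" "\<zero>\<^bsub>M\<^esub> \<in> H" "\<And>x y. x \<in> H \<Longrightarrow> y \<in> H \<Longrightarrow> x \<oplus>\<^bsub>M\<^esub> y \<in> H"
    "\<And>a x. a \<in> carrier R \<Longrightarrow> x \<in> H \<Longrightarrow> a \<odot>\<^bsub>M\<^esub> x \<in> H"
    using assms unfolding submodule_iff by auto
  have "abelian_group (M\<lparr>carrier := H\<rparr>)"
  proof (rule abelian_groupI, simp_all add: H)
    fix x y z assume "x \<in> H" "y \<in> H" "z \<in> H"
    then have xyz: "x \<in> carrier M" "y \<in> carrier M" "z \<in> carrier M"
      using H(1) by auto
    show "x \<oplus>\<^bsub>M\<^esub> y \<oplus>\<^bsub>M\<^esub> z = x \<oplus>\<^bsub>M\<^esub> (y \<oplus>\<^bsub>M\<^esub> z)"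
      by (simp add: xyz M.a_assoc)
  next
    fix x y assume "x \<in> H" "y \<in> H"
    then have xy: "x \<in> carrier M" "y \<in> carrier M"
      using H(1) by auto
    show "x \<oplus>\<^bsub>M\<^esub> y = y \<oplus>\<^bsub>M\<^esub> x"
      by (simp add: xy M.a_comm)
  next
    fix x assume x: "x \<in> H"
    then have xM: "x \<in> carrier M"
      using H(1) by auto
    then show "\<zero>\<^bsub>M\<^esub> \<oplus>\<^bsub>M\<^esub> x = x"
      by simp
    show "\<exists>y\<in>H. y \<oplus>\<^bsub>M\<^esub> x = \<zero>\<^bsub>M\<^esub>"
      using submodule_a_inv_closed[OF assms x] M.l_neg[OF xM] by blast
  qed
  then show ?thesis
    using H by (auto simp: left_module_def left_module_axioms_def R.ring_axioms
        smult_l_distr smult_r_distr smult_assoc1 subset_eq)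
qed

lemma submodule_restrict_iff:
  assumes "submodule V R M"
  shows "submodule W R (M\<lparr>carrier := V\<rparr>) \<longleftrightarrow> submodule W R M \<and> W \<subseteq> V"
proof -
  interpret V: left_module R "M\<lparr>carrier := V\<rparr>"
    using left_module_submodule[OF assms] .
  show ?thesis
    using assms by (auto simp: V.submodule_iff submodule_iff)
qed

text \<open>The module axioms are closure conditions, equations and the existence of negatives, and
  all of these pass along a surjection that respects the operations. As \<open>Q\<close> starts as a
  bare record, this is the way to recognise a quotient built by hand as a module.\<close>

lemma left_module_image:
  fixes Q :: "('r, 'q, 'd) module_scheme"
  assumes surj: "p ` carrier M = carrier Q"
    and zero: "p \<zero>\<^bsub>M\<^esub> = \<zero>\<^bsub>Q\<^esub>"
    and add: "\<And>x y. \<lbrakk>x \<in> carrier M; y \<in> carrier M\<rbrakk> \<Longrightarrow> p (x \<oplus>\<^bsub>M\<^esub> y) = p x \<oplus>\<^bsub>Q\<^esub> p y"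
    and smult: "\<And>a x. \<lbrakk>a \<in> carrier R; x \<in> carrier M\<rbrakk> \<Longrightarrow> p (a \<odot>\<^bsub>M\<^esub> x) = a \<odot>\<^bsub>Q\<^esub> p x"
  shows "left_module R Q"
proof -
  have "\<exists>y\<in>carrier M. p (x \<oplus>\<^bsub>M\<^esub> y) = p \<zero>\<^bsub>M\<^esub>" if "x \<in> carrier M" for x
    using that M.r_neg M.a_inv_closed by metis
  then have "abelian_group Q"
    by (intro abelian_groupI)
      (auto simp: surj[symmetric] zero[symmetric] add[symmetric] M.a_ac)
  moreover have "left_module_axioms R Q"
    by (rule left_module_axioms.intro)
      (auto simp: surj[symmetric] add[symmetric] smult[symmetric]
        smult_l_distr smult_r_distr smult_assoc1)
  ultimately show ?thesis
    by (simp add: left_module_def R.ring_axioms)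
qed

end

section \<open>Module homomorphisms and their effect on submodules and radicals\<close>

locale left_module_hom = M: left_module R M + N: left_module R N
  for R :: "('r, 'k) ring_scheme" (structure)
    and M :: "('r, 'm, 'c) module_scheme"
    and N :: "('r, 'n, 'd) module_scheme"
    and h :: "'m \<Rightarrow> 'n" +
  assumes hom_closed [simp]: "x \<in> carrier M \<Longrightarrow> h x \<in> carrier N"
    and hom_add: "\<lbrakk>x \<in> carrier M; y \<in> carrier M\<rbrakk> \<Longrightarrow> h (x \<oplus>\<^bsub>M\<^esub> y) = h x \<oplus>\<^bsub>N\<^esub> h y"
    and hom_smult: "\<lbrakk>a \<in> carrier R; x \<in> carrier M\<rbrakk> \<Longrightarrow> h (a \<odot>\<^bsub>M\<^esub> x) = a \<odot>\<^bsub>N\<^esub> h x"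
begin

lemma hom_zero: "h \<zero>\<^bsub>M\<^esub> = \<zero>\<^bsub>N\<^esub>"
  using hom_smult[of \<zero> "\<zero>\<^bsub>M\<^esub>"] by (simp add: M.smult_l_zero N.smult_l_zero)

lemma hom_minus:
  assumes "x \<in> carrier M" "y \<in> carrier M"
  shows "h (x \<ominus>\<^bsub>M\<^esub> y) = h x \<ominus>\<^bsub>N\<^esub> h y"
  using assms hom_smult[of "\<ominus> \<one>" y]
  by (simp add: a_minus_def hom_add M.smult_minus_one N.smult_minus_one)

lemma hom_eq_iff:
  assumes "x \<in> carrier M" "y \<in> carrier M"
  shows "h x = h y \<longleftrightarrow> h (x \<ominus>\<^bsub>M\<^esub> y) = \<zero>\<^bsub>N\<^esub>"
proof -
  have "h x = h y" if "h x \<ominus>\<^bsub>N\<^esub> h y = \<zero>\<^bsub>N\<^esub>"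
    using assms that N.M.minus_equality[of "h x" "\<ominus>\<^bsub>N\<^esub> h y"] by (simp add: a_minus_def)
  then show ?thesis
    using assms by (auto simp: hom_minus) (simp add: a_minus_def N.M.r_neg)
qed

lemma submodule_image:
  assumes "submodule H R M"
  shows "submodule (h ` H) R N"
proof -
  have H: "H \<subseteq> carrier M" "\<zero>\<^bsub>M\<^esub> \<in> H" "\<And>x y. x \<in> H \<Longrightarrow> y \<in> H \<Longrightarrow> x \<oplus>\<^bsub>M\<^esub> y \<in> H"
    "\<And>a x. a \<in> carrier R \<Longrightarrow> x \<in> H \<Longrightarrow> a \<odot>\<^bsub>M\<^esub> x \<in> H"
    using assms unfolding M.submodule_iff by auto
  have "h x \<oplus>\<^bsub>N\<^esub> h y \<in> h ` H" if "x \<in> H" "y \<in> H" for x y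
    using that H hom_add[of x y] by (metis imageI subsetD)
  moreover have "a \<odot>\<^bsub>N\<^esub> h x \<in> h ` H" if "a \<in> carrier R" "x \<in> H" for a x
    using that H hom_smult[of a x] by (metis imageI subsetD)
  moreover have "\<zero>\<^bsub>N\<^esub> \<in> h ` H"
    using H(2) hom_zero by (metis imageI)
  ultimately show ?thesis
    using H(1) by (auto simp: N.submodule_iff)
qed

lemma submodule_preimage:
  assumes "submodule H R N"
  shows "submodule {x \<in> carrier M. h x \<in> H} R M"
  using assms by (auto simp: M.submodule_iff N.submodule_iff hom_zero hom_add hom_smult)

lemma hom_restrict:
  assumes "submodule H R M" "submodule L R N" "h ` H \<subseteq> L"
  shows "left_module_hom R (M\<lparr>carrier := H\<rparr>) (N\<lparr>carrier := L\<rparr>) h"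
proof -
  have "H \<subseteq> carrier M"
    using assms(1) by (simp add: M.submodule_iff)
  then show ?thesis
    using assms(3)
    by (auto simp: left_module_hom_def left_module_hom_axioms_def hom_add hom_smult subset_eq
        M.left_module_submodule[OF assms(1)] N.left_module_submodule[OF assms(2)])
qed

lemma hom_comp:
  assumes "left_module_hom R N Q g"
  shows "left_module_hom R M Q (g \<circ> h)"
proof -
  interpret g: left_module_hom R N Q g
    using assms .
  show ?thesis
    by unfold_locales (auto simp: hom_add hom_smult g.hom_add g.hom_smult)
qed

lemma module_embedding_iff: "module_embedding R M N h \<longleftrightarrow> inj_on h (carrier M)"
  by (auto simp: module_embedding_def hom_def hom_add hom_smult)

lemma module_embedding_restrict:
  assumes "module_embedding R M N h" "submodule H R M" "submodule L R N" "h ` H \<subseteq> L"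
  shows "module_embedding R (M\<lparr>carrier := H\<rparr>) (N\<lparr>carrier := L\<rparr>) h"
proof -
  interpret HL: left_module_hom R "M\<lparr>carrier := H\<rparr>" "N\<lparr>carrier := L\<rparr>" h
    using hom_restrict[OF assms(2-4)] .
  show ?thesis
    using inj_on_subset[of h "carrier M" H] assms(1,2)
    unfolding HL.module_embedding_iff module_embedding_iff M.submodule_iff by simp
qed

text \<open>Every maximal submodule \<open>K\<close> of \<open>M\<close> contains the radical and
  hence the kernel, so it is a union of fibres of \<open>h\<close> and its image is maximal in
  \<open>N\<close>. Thus \<open>h x\<close> lies in the image of \<open>K\<close>, which forces
  \<open>x\<close> into \<open>K\<close>.\<close>

lemma mem_RadI:
  assumes surj: "h ` carrier M = carrier N"
    and ker: "\<And>x. x \<in> carrier M \<Longrightarrow> h x = \<zero>\<^bsub>N\<^esub> \<Longrightarrow> x \<in> Rad R M"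
    and x: "x \<in> carrier M" "h x \<in> Rad R N"
  shows "x \<in> Rad R M"
proof -
  have "x \<in> K" if max: "maximal_submodule K R M" for K
  proof -
    have K: "submodule K R M" "K \<noteq> carrier M"
      "\<And>L. submodule L R M \<Longrightarrow> K \<subseteq> L \<Longrightarrow> L = K \<or> L = carrier M"
      using max by (auto simp: maximal_submodule_def)
    have Ksub: "K \<subseteq> carrier M"
      using K(1) by (simp add: M.submodule_iff)
    \<comment> \<open>If \<open>h y = h k\<close>, the difference of \<open>y\<close> and
      \<open>k\<close> is in the kernel, hence in the radical and in \<open>K\<close>; adding
      \<open>k\<close> back gives \<open>y\<close>.\<close>
    have saturated: "y \<in> K" if y: "y \<in> carrier M" and hy: "h y \<in> h ` K" for y
    proof -
      obtain k where k: "k \<in> K" "h y = h k"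
        using hy by auto
      then have kM: "k \<in> carrier M"
        using Ksub by auto
      have "y \<ominus>\<^bsub>M\<^esub> k \<in> Rad R M"
        using ker[of "y \<ominus>\<^bsub>M\<^esub> k"] hom_eq_iff[OF y kM] k(2) y kM by simp
      then have "y \<ominus>\<^bsub>M\<^esub> k \<in> K"
        using max by (auto simp: Rad_def)
      then have "y \<ominus>\<^bsub>M\<^esub> k \<oplus>\<^bsub>M\<^esub> k \<in> K"
        using k(1) K(1) by (simp add: M.submodule_iff)
      moreover have "y \<ominus>\<^bsub>M\<^esub> k \<oplus>\<^bsub>M\<^esub> k = y"
        using y kM by (simp add: a_minus_def M.M.a_assoc M.M.l_neg)
      ultimately show ?thesis
        by simp
    qed
    \<comment> \<open>The image is proper: otherwise \<open>saturated\<close> would put all of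
      \<open>M\<close> into \<open>K\<close>.\<close>
    have "maximal_submodule (h ` K) R N"
      unfolding maximal_submodule_def
    proof (intro conjI allI impI)
      show "submodule (h ` K) R N"
        using submodule_image[OF K(1)] .
      show "h ` K \<noteq> carrier N"
        using saturated K(2) Ksub by (metis hom_closed subsetI subset_antisym)
    next
      fix L assume L: "submodule L R N \<and> h ` K \<subseteq> L"
      \<comment> \<open>The preimage of \<open>L\<close> lies above \<open>K\<close>, so maximality
        of \<open>K\<close> leaves two options for it; surjectivity recovers \<open>L\<close> as the
        image of its preimage.\<close>
      let ?P = "{x \<in> carrier M. h x \<in> L}"
      have "L \<subseteq> carrier N"
        using L by (simp add: N.submodule_iff)
      then have "L = h ` ?P"
        using surj by auto
      moreover have "?P = K \<or> ?P = carrier M"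
        using K(3) L submodule_preimage[of L] Ksub by auto
      ultimately show "L = h ` K \<or> L = carrier N"
        using surj by metis
    qed
    then have "h x \<in> h ` K"
      using x(2) by (auto simp: Rad_def)
    then show ?thesis
      using saturated x(1) by blast
  qed
  then show ?thesis
    using x(1) by (auto simp: Rad_def)
qed

end

lemma left_module_hom_embedding:
  assumes "left_module R M" "left_module R N" "module_embedding R M N f"
  shows "left_module_hom R M N f"
  using assms
  by (auto simp: left_module_hom_def left_module_hom_axioms_def module_embedding_def hom_def)

section \<open>Quotients\<close>

context left_module
begin

section \<open>Cosets and their compatibility with the operations\<close>

lemma coset_eq_iff:
  assumes "submodule U R M" "x \<in> carrier M" "y \<in> carrier M"
  shows "U +>\<^bsub>M\<^esub> x = U +>\<^bsub>M\<^esub> y \<longleftrightarrow> x \<ominus>\<^bsub>M\<^esub> y \<in> U"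
proof -
  interpret U: abelian_subgroup U M
    using submodule_abelian_subgroup[OF assms(1)] .
  show ?thesis
  proof
    assume "U +>\<^bsub>M\<^esub> x = U +>\<^bsub>M\<^esub> y"
    then have "x \<in> U +>\<^bsub>M\<^esub> y"
      using U.a_rcos_self[OF assms(2)] by simp
    then show "x \<ominus>\<^bsub>M\<^esub> y \<in> U"
      using U.a_rcos_module_imp[OF assms(3)] by (simp add: a_minus_def)
  next
    assume "x \<ominus>\<^bsub>M\<^esub> y \<in> U"
    then have "x \<in> U +>\<^bsub>M\<^esub> y"
      using U.a_rcos_module_rev[OF assms(3,2)] by (simp add: a_minus_def)
    then show "U +>\<^bsub>M\<^esub> x = U +>\<^bsub>M\<^esub> y"
      using M.a_repr_independence[OF _ assms(3) U.a_subgroup] by metis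
  qed
qed

lemma coset_add_cong:
  assumes "submodule U R M" "x \<in> carrier M" "y \<in> carrier M" "x' \<in> carrier M" "y' \<in> carrier M"
    and "U +>\<^bsub>M\<^esub> x = U +>\<^bsub>M\<^esub> x'" "U +>\<^bsub>M\<^esub> y = U +>\<^bsub>M\<^esub> y'"
  shows "U +>\<^bsub>M\<^esub> (x \<oplus>\<^bsub>M\<^esub> y) = U +>\<^bsub>M\<^esub> (x' \<oplus>\<^bsub>M\<^esub> y')"
proof -
  interpret U: abelian_subgroup U M
    using submodule_abelian_subgroup[OF assms(1)] .
  show ?thesis
    using assms by (simp add: U.a_rcos_sum[symmetric])
qed

lemma coset_smult_cong:
  assumes U: "submodule U R M" and a: "a \<in> carrier R"
    and xy: "x \<in> carrier M" "y \<in> carrier M" and eq: "U +>\<^bsub>M\<^esub> x = U +>\<^bsub>M\<^esub> y"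
  shows "U +>\<^bsub>M\<^esub> (a \<odot>\<^bsub>M\<^esub> x) = U +>\<^bsub>M\<^esub> (a \<odot>\<^bsub>M\<^esub> y)"
proof -
  have "a \<odot>\<^bsub>M\<^esub> (x \<ominus>\<^bsub>M\<^esub> y) \<in> U"
    using coset_eq_iff[OF U xy] eq U a by (simp add: submodule_iff)
  moreover have "a \<odot>\<^bsub>M\<^esub> (x \<ominus>\<^bsub>M\<^esub> y) = a \<odot>\<^bsub>M\<^esub> x \<ominus>\<^bsub>M\<^esub> a \<odot>\<^bsub>M\<^esub> y"
  proof -
    have "a \<odot>\<^bsub>M\<^esub> (x \<ominus>\<^bsub>M\<^esub> y) \<oplus>\<^bsub>M\<^esub> a \<odot>\<^bsub>M\<^esub> y = a \<odot>\<^bsub>M\<^esub> x"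
      using a xy by (simp add: smult_r_distr[symmetric] a_minus_def M.a_assoc M.l_neg)
    moreover have "a \<odot>\<^bsub>M\<^esub> x \<ominus>\<^bsub>M\<^esub> a \<odot>\<^bsub>M\<^esub> y \<oplus>\<^bsub>M\<^esub> a \<odot>\<^bsub>M\<^esub> y = a \<odot>\<^bsub>M\<^esub> x"
      using a xy by (simp add: a_minus_def M.a_assoc M.l_neg)
    ultimately show ?thesis
      using a xy by (metis M.add.right_cancel M.minus_closed smult_closed)
  qed
  ultimately show ?thesis
    using coset_eq_iff[OF U] a xy by simp
qed

text \<open>Cosets themselves would live on \<open>'m set\<close>, outside the type over which
  \<open>rad_supplementing\<close> quantifies. One chosen element per coset gives a copy of the
  quotient on \<open>'m\<close>.\<close>

lemma exists_quotient_on_same_type: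
  assumes U: "submodule U R M"
  obtains Q :: "('r, 'm) module" and p
  where "left_module_hom R M Q p" "p ` carrier M = carrier Q"
    "\<And>x. x \<in> carrier M \<Longrightarrow> p x = \<zero>\<^bsub>Q\<^esub> \<longleftrightarrow> x \<in> U"
proof -
  interpret U: abelian_subgroup U M
    using submodule_abelian_subgroup[OF U] .
  \<comment> \<open>The choice depends on \<open>x\<close> only through its coset, so
    \<open>p\<close> normalises every element to the representative of its coset. The operations of
    \<open>Q\<close> are those of \<open>M\<close> followed by normalisation; its zero is the
    representative of \<open>U\<close>, which may differ from the zero of \<open>M\<close>.\<close>
  define p where "p x = (SOME y. y \<in> U +>\<^bsub>M\<^esub> x)" for x
  define Q :: "('r, 'm) module" where
    "Q = \<lparr>carrier = p ` carrier M, mult = undefined, one = undefined, zero = p \<zero>\<^bsub>M\<^esub>,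
      add = (\<lambda>x y. p (x \<oplus>\<^bsub>M\<^esub> y)), smult = (\<lambda>a x. p (a \<odot>\<^bsub>M\<^esub> x))\<rparr>"
  have p_mem: "p x \<in> U +>\<^bsub>M\<^esub> x" if "x \<in> carrier M" for x
    unfolding p_def using U.a_rcos_self[OF that] by (rule someI)
  have pM: "p x \<in> carrier M" if "x \<in> carrier M" for x
    using p_mem[OF that] M.a_r_coset_subset_G[OF U.a_subset that] by auto
  have coset_p: "U +>\<^bsub>M\<^esub> p x = U +>\<^bsub>M\<^esub> x" if "x \<in> carrier M" for x
    using M.a_repr_independence[OF p_mem[OF that] that U.a_subgroup] by simp
  have p_eq: "p x = p y \<longleftrightarrow> U +>\<^bsub>M\<^esub> x = U +>\<^bsub>M\<^esub> y" if "x \<in> carrier M" "y \<in> carrier M" for x y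
    using coset_p that by (metis p_def)
  have add: "p (x \<oplus>\<^bsub>M\<^esub> y) = p (p x \<oplus>\<^bsub>M\<^esub> p y)" if "x \<in> carrier M" "y \<in> carrier M" for x y
    using coset_add_cong[OF U, of x y "p x" "p y"] that by (simp add: p_eq pM coset_p)
  have smult: "p (a \<odot>\<^bsub>M\<^esub> x) = p (a \<odot>\<^bsub>M\<^esub> p x)" if "a \<in> carrier R" "x \<in> carrier M" for a x
    using coset_smult_cong[OF U, of a x "p x"] that by (simp add: p_eq pM coset_p)
  have "left_module R Q"
    by (rule left_module_image[where p = p]) (auto simp: Q_def add smult)
  then have "left_module_hom R M Q p"
    by (auto simp: left_module_hom_def left_module_hom_axioms_def left_module_axioms
        Q_def add smult)
  moreover have "p ` carrier M = carrier Q"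
    by (simp add: Q_def)
  moreover have "p x = \<zero>\<^bsub>Q\<^esub> \<longleftrightarrow> x \<in> U" if "x \<in> carrier M" for x
    using that coset_eq_iff[OF U that M.zero_closed] M.minus_equality[of "\<zero>\<^bsub>M\<^esub>" "\<zero>\<^bsub>M\<^esub>"]
    by (simp add: Q_def p_eq a_minus_def)
  ultimately show thesis
    using that by blast
qed

end

text \<open>The first isomorphism theorem. It links \<open>quotient_module\<close>, whose elements
  are sets, to a submodule of a module on another type.\<close>

lemma (in left_module_hom) exists_quotient_embedding:
  assumes U: "submodule U R M"
    and ker: "\<And>x. x \<in> carrier M \<Longrightarrow> h x = \<zero>\<^bsub>N\<^esub> \<longleftrightarrow> x \<in> U"
  obtains g where "module_embedding R (quotient_module M U) N g"
    "g ` carrier (quotient_module M U) = h ` carrier M"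
proof -
  interpret U: abelian_subgroup U M
    using M.submodule_abelian_subgroup[OF U] .
  \<comment> \<open>Any representative will do, because \<open>h\<close> is constant on cosets of
    its kernel (\<open>coset_iff\<close>).\<close>
  define g where "g C = h (SOME x. x \<in> C)" for C
  have coset_iff: "U +>\<^bsub>M\<^esub> x = U +>\<^bsub>M\<^esub> y \<longleftrightarrow> h x = h y"
    if "x \<in> carrier M" "y \<in> carrier M" for x y
    using that M.coset_eq_iff[OF U that] hom_eq_iff[OF that] ker by simp
  have g_coset: "g (U +>\<^bsub>M\<^esub> x) = h x" if x: "x \<in> carrier M" for x
  proof -
    have mem: "(SOME y. y \<in> U +>\<^bsub>M\<^esub> x) \<in> U +>\<^bsub>M\<^esub> x"
      using U.a_rcos_self[OF x] by (rule someI)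
    then have "(SOME y. y \<in> U +>\<^bsub>M\<^esub> x) \<in> carrier M"
      using M.M.a_r_coset_subset_G[OF U.a_subset x] by auto
    then show ?thesis
      using M.M.a_repr_independence[OF mem x U.a_subgroup] coset_iff x by (simp add: g_def)
  qed
  \<comment> \<open>All members of the union are the same coset, and the index set is nonempty since
    it contains \<open>x\<close>.\<close>
  have smult_coset: "(\<Union>y\<in>U +>\<^bsub>M\<^esub> x. U +>\<^bsub>M\<^esub> (a \<odot>\<^bsub>M\<^esub> y)) = U +>\<^bsub>M\<^esub> (a \<odot>\<^bsub>M\<^esub> x)"
    if a: "a \<in> carrier R" and x: "x \<in> carrier M" for a x
  proof -
    have "U +>\<^bsub>M\<^esub> (a \<odot>\<^bsub>M\<^esub> y) = U +>\<^bsub>M\<^esub> (a \<odot>\<^bsub>M\<^esub> x)" if y: "y \<in> U +>\<^bsub>M\<^esub> x" for y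
    proof -
      have "y \<in> carrier M"
        using y M.M.a_r_coset_subset_G[OF U.a_subset x] by auto
      then show ?thesis
        using M.coset_smult_cong[OF U a x _ M.M.a_repr_independence[OF y x U.a_subgroup]] by simp
    qed
    then show ?thesis
      using U.a_rcos_self[OF x] by blast
  qed
  have "module_embedding R (quotient_module M U) N g"
    by (auto simp: module_embedding_def quotient_module_def hom_def A_RCOSETS_def' inj_on_def
        g_coset U.a_rcos_sum smult_coset hom_add hom_smult coset_iff)
  moreover have "g ` carrier (quotient_module M U) = h ` carrier M"
    by (force simp: quotient_module_def A_RCOSETS_def' g_coset)
  ultimately show thesis
    using that by blast
qed

section \<open>Extensions of Rad-supplementing modules\<close>

lemma rad_supplementingE:
  fixes N :: "('r, 'n) module"
  assumes "rad_supplementing TYPE('n) R M" "left_module R N" "module_embedding R M N f"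
  obtains V where "rad_supplement R N (f ` carrier M) V"
  using assms unfolding rad_supplementing_def by blast

theorem proposition2p6:
  fixes R :: "('r, 'k) ring_scheme"
    and B :: "('r, 'b, 'c) module_scheme"
    and A :: "'b set"
  assumes "ring R"
    and "left_module R B"
    and "submodule A R B"
    and "rad_supplementing TYPE('n) R (B\<lparr>carrier := A\<rparr>)"
    and "rad_supplementing TYPE('n) R (quotient_module B A)"
  shows "rad_supplementing TYPE('n) R B"
  unfolding rad_supplementing_def
proof (intro allI impI)
  fix N :: "('r, 'n) module" and f
  assume "left_module R N \<and> module_embedding R B N f"
  then have N: "left_module R N" and f: "module_embedding R B N f"
    by auto
  interpret f: left_module_hom R B N f
    using left_module_hom_embedding[OF assms(2) N f] .
  have A_sub: "A \<subseteq> carrier B"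
    using assms(3) by (simp add: f.M.submodule_iff)
  have fB: "submodule (f ` carrier B) R N"
    by (rule f.submodule_image) (simp add: f.M.submodule_iff)
  have fA: "submodule (f ` A) R N"
    using f.submodule_image[OF assms(3)] .
  \<comment> \<open>\<open>Q\<close> is N/f(A) on the type \<open>'n\<close>, so the hypothesis on
    B/A applies to it.\<close>
  obtain Q :: "('r, 'n) module" and p where p_hom: "left_module_hom R N Q p"
    and p_surj: "p ` carrier N = carrier Q"
    and p_ker: "\<And>x. x \<in> carrier N \<Longrightarrow> p x = \<zero>\<^bsub>Q\<^esub> \<longleftrightarrow> x \<in> f ` A"
    using f.N.exists_quotient_on_same_type[OF fA] by blast
  interpret p: left_module_hom R N Q p
    using p_hom .
  interpret pf: left_module_hom R B Q "p \<circ> f"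
    using f.hom_comp[OF p_hom] .
  \<comment> \<open>Injectivity of \<open>f\<close> turns membership of \<open>f x\<close> in f(A)
    into membership of \<open>x\<close> in \<open>A\<close>.\<close>
  have pf_ker: "(p \<circ> f) x = \<zero>\<^bsub>Q\<^esub> \<longleftrightarrow> x \<in> A" if "x \<in> carrier B" for x
    using that p_ker[of "f x"] A_sub f by (auto simp: f.module_embedding_iff inj_on_def)
  obtain g where g: "module_embedding R (quotient_module B A) Q g"
    "g ` carrier (quotient_module B A) = (p \<circ> f) ` carrier B"
    using pf.exists_quotient_embedding[OF assms(3) pf_ker] by blast
  obtain S where S: "rad_supplement R Q ((p \<circ> f) ` carrier B) S"
    using rad_supplementingE[OF assms(5) p.N.left_module_axioms g(1)] g(2) by metis
  then have S_sub: "submodule S R Q"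
    and S_sum: "(p \<circ> f) ` carrier B <+>\<^bsub>Q\<^esub> S = carrier Q"
    and S_Rad: "(p \<circ> f) ` carrier B \<inter> S \<subseteq> Rad R (Q\<lparr>carrier := S\<rparr>)"
    by (auto simp: rad_supplement_def)
  \<comment> \<open>The full preimage of \<open>S\<close>: it contains f(A), the kernel of
    \<open>p\<close>, and \<open>p\<close> maps it onto \<open>S\<close>, so \<open>S\<close> is a
    copy of V/f(A).\<close>
  define V where "V = {x \<in> carrier N. p x \<in> S}"
  have V: "submodule V R N"
    unfolding V_def using p.submodule_preimage[OF S_sub] .
  have fA_V: "f ` A \<subseteq> V"
  proof
    fix x assume x: "x \<in> f ` A"
    then have "x \<in> carrier N"
      using A_sub by auto
    then show "x \<in> V"
      using x p_ker[of x] S_sub by (simp add: V_def p.N.submodule_iff)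
  qed
  \<comment> \<open>\<open>f\<close> restricts to an embedding of \<open>A\<close> into
    \<open>V\<close>, so the hypothesis on \<open>A\<close> gives a supplement inside
    \<open>V\<close>.\<close>
  obtain W where W: "rad_supplement R (N\<lparr>carrier := V\<rparr>) (f ` A) W"
    using rad_supplementingE[OF assms(4) f.N.left_module_submodule[OF V]
        f.module_embedding_restrict[OF f assms(3) V fA_V]]
    by auto
  \<comment> \<open>Restricting the carrier to \<open>V\<close> and then to \<open>W\<close> is the
    same as restricting it to \<open>W\<close> at once, so the radical of \<open>W\<close> is
    already taken within \<open>N\<close>.\<close>
  then have W_sub: "submodule W R N" and W_V: "W \<subseteq> V"
    and W_sum: "f ` A <+>\<^bsub>N\<^esub> W = V"
    and W_Rad: "f ` A \<inter> W \<subseteq> Rad R (N\<lparr>carrier := W\<rparr>)"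
    by (simp_all add: rad_supplement_def f.N.submodule_restrict_iff[OF V] set_add_defs)
  have W_N: "W \<subseteq> carrier N"
    using W_sub by (simp add: f.N.submodule_iff)
  \<comment> \<open>Each element of \<open>V\<close> is a sum from f(A) and \<open>W\<close>, and
    \<open>p\<close> kills the first summand.\<close>
  have pW: "p ` W = S"
  proof
    show "p ` W \<subseteq> S"
      using W_V by (auto simp: V_def)
    show "S \<subseteq> p ` W"
    proof
      fix s assume s: "s \<in> S"
      then have "s \<in> p ` carrier N"
        using S_sub p_surj by (auto simp: p.N.submodule_iff)
      then obtain v where v: "v \<in> V" "s = p v"
        using s by (auto simp: V_def)
      then obtain a w where aw: "a \<in> f ` A" "w \<in> W" "v = a \<oplus>\<^bsub>N\<^esub> w"
        using W_sum by (auto simp: set_add_def')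
      then have "a \<in> carrier N" "w \<in> carrier N"
        using A_sub W_N by auto
      then have "s = p w"
        using p_ker[of a] aw v(2) by (simp add: p.hom_add)
      then show "s \<in> p ` W"
        using aw(2) by simp
    qed
  qed
  interpret pW: left_module_hom R "N\<lparr>carrier := W\<rparr>" "Q\<lparr>carrier := S\<rparr>" p
    using p.hom_restrict[OF W_sub S_sub] pW by simp
  have "f ` carrier B \<inter> W \<subseteq> Rad R (N\<lparr>carrier := W\<rparr>)"
  proof
    fix x assume x: "x \<in> f ` carrier B \<inter> W"
    then have "p x \<in> Rad R (Q\<lparr>carrier := S\<rparr>)"
      using S_Rad pW by auto
    \<comment> \<open>The kernel of \<open>p\<close> on \<open>W\<close> is the intersection of f(A)
      and \<open>W\<close>, which lies in the radical by the choice of \<open>W\<close>. This is the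
      kernel condition of \<open>mem_RadI\<close>.\<close>
    moreover have "y \<in> Rad R (N\<lparr>carrier := W\<rparr>)" if "y \<in> W" "p y = \<zero>\<^bsub>Q\<^esub>" for y
      using that p_ker[of y] W_N W_Rad by (metis IntI subsetD)
    ultimately show "x \<in> Rad R (N\<lparr>carrier := W\<rparr>)"
      using x pW by - (rule pW.mem_RadI, simp_all)
  qed
  moreover have "f ` carrier B <+>\<^bsub>N\<^esub> W = carrier N"
  proof
    show "f ` carrier B <+>\<^bsub>N\<^esub> W \<subseteq> carrier N"
      by (intro f.N.M.setadd_subset_G W_N) auto
    show "carrier N \<subseteq> f ` carrier B <+>\<^bsub>N\<^esub> W"
    proof
      fix x assume x: "x \<in> carrier N"
      then have "p x \<in> (p \<circ> f) ` carrier B <+>\<^bsub>Q\<^esub> S"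
        using S_sum by simp
      \<comment> \<open>As \<open>S\<close> is the image of \<open>W\<close>, the second summand can
        be taken as \<open>p w\<close> with \<open>w\<close> in \<open>W\<close>. The error left in
        \<open>N\<close> then lies in f(A) and is absorbed into the summand from f(B).\<close>
      then obtain b w where b: "b \<in> carrier B" and w: "w \<in> W"
        and "p x = p (f b) \<oplus>\<^bsub>Q\<^esub> p w"
        using pW by (force simp: set_add_def')
      moreover have wN: "w \<in> carrier N"
        using w W_N by auto
      ultimately have "p x = p (f b \<oplus>\<^bsub>N\<^esub> w)"
        by (simp add: p.hom_add)
      then have "x \<ominus>\<^bsub>N\<^esub> (f b \<oplus>\<^bsub>N\<^esub> w) \<in> f ` A"
        using p.hom_eq_iff[of x "f b \<oplus>\<^bsub>N\<^esub> w"] p_ker x b wN by simp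
      then obtain a where a: "a \<in> A" "x \<ominus>\<^bsub>N\<^esub> (f b \<oplus>\<^bsub>N\<^esub> w) = f a"
        by auto
      have aB: "a \<in> carrier B"
        using a(1) A_sub by auto
      have "x = x \<ominus>\<^bsub>N\<^esub> (f b \<oplus>\<^bsub>N\<^esub> w) \<oplus>\<^bsub>N\<^esub> (f b \<oplus>\<^bsub>N\<^esub> w)"
        using x b wN by (simp add: a_minus_def f.N.M.a_assoc f.N.M.l_neg)
      also have "\<dots> = f (a \<oplus>\<^bsub>B\<^esub> b) \<oplus>\<^bsub>N\<^esub> w"
        using aB b wN by (simp add: a(2) f.hom_add f.N.M.a_assoc)
      finally show "x \<in> f ` carrier B <+>\<^bsub>N\<^esub> W"
        using aB b w by (auto simp: set_add_def')
    qed
  qed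
  ultimately have "rad_supplement R N (f ` carrier B) W"
    using fB W_sub by (simp add: rad_supplement_def)
  then show "\<exists>V. rad_supplement R N (f ` carrier B) V" ..
qed

end
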